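(* For $n\ge 3$ let $C_n$ be the $n$-cycle (the connected graph with $n$ vertices all of degree $2$) and let $S_{C_n}$ denote the number of invertible Schr\"odinger operators of $C_n$ over $\mathbb F_q$, $q$ a prime power. If $q$ is odd then, for all $n\ge1$, $$S_{C_{2n+1}}=q^{2n+1}-\frac{1-q^{2n+2}}{1-q^2},\qquad S_{C_{4n}}=q^{4n}-q^{2n}+\frac{(1-q^{2n})(1-q^{2n+1})}{1-q^2},$$ $$S_{C_{4n+2}}=q^{4n+2}+\frac{(1-q^{2n+1})(1-q^{2n+2})}{1-q^2}.$$ If $q$ is even then $$S_{C_{2n+1}}=q^{2n+1}-\frac{1-q^{2n+2}}{1-q^2}\quad(n\ge1),\qquad S_{C_{2n}}=q^{2n}-q^{n}+\frac{(1-q^{n})(1-q^{n+1})}{1-q^2}\quad(n\ge2).$$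
   Context: A Schr\"odinger operator of a graph $G$ over a field $\mathbb F$ is a matrix $A+D$ where $A$ is the adjacency matrix of $G$ and $D$ is an arbitrary diagonal matrix over $\mathbb F$. The number of invertible Schr\"odinger operators over $\mathbb F_q$ is the number of diagonal matrices $D$ over $\mathbb F_q$ with $A+D$ invertible. *)

theory Defs
  imports
    "Graph_Theory.Pair_Digraph"
    "Graph_Theory.Digraph_Component"
    "Jordan_Normal_Form.Matrix"
    "HOL-Library.Cardinality"
begin

text \<open>
  A finite simple graph is a \<^locale>\<open>pair_graph\<close>: a finite digraph without loops and without
  parallel arcs whose arc relation is symmetric, every edge being represented by its two
  orientations.  Consequently the degree of a vertex is its out-degree.  The graphs below have
  vertex set \<open>{0..<n}\<close>, which fixes the indexing of rows and columns.
\<close>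

definition adjacency_mat :: "nat pair_pre_digraph \<Rightarrow> 'a::zero_neq_one mat" where
  "adjacency_mat G =
     mat (card (pverts G)) (card (pverts G)) (\<lambda>(i, j). if (i, j) \<in> parcs G then 1 else 0)"

definition invertible_schroedinger_count :: "'a::field itself \<Rightarrow> nat pair_pre_digraph \<Rightarrow> nat" where
  "invertible_schroedinger_count _ G =
     card {D :: 'a mat. D \<in> carrier_mat (card (pverts G)) (card (pverts G)) \<and>
       diagonal_mat D \<and> invertible_mat (adjacency_mat G + D)}"

definition is_cycle_graph :: "nat \<Rightarrow> nat pair_pre_digraph \<Rightarrow> bool" where
  "is_cycle_graph n G \<longleftrightarrow>
     pair_graph G \<and> pverts G = {0..<n} \<and>
     Digraph_Component.connected (with_proj G) \<and>
     (\<forall>v \<in> pverts G. out_degree (with_proj G) v = 2)"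

lemma is_cycle_graph_exists:
  assumes n: "n \<ge> 3"
  shows "\<exists>G. is_cycle_graph n G"
proof -
  define G where "G = \<lparr>pverts = {0..<n},
    parcs = {(i, j). i < n \<and> j < n \<and> (j = Suc i mod n \<or> i = Suc j mod n)}\<rparr>"
  have no_loop: "Suc i mod n \<noteq> i" if "i < n" for i
    using that n by (cases "Suc i = n") auto
  have graph: "pair_graph G"
  proof
    show "finite (parcs G)"
      by (rule finite_subset[of _ "{0..<n} \<times> {0..<n}"]) (auto simp: G_def)
    show "symmetric (with_proj G)"
      by (auto simp: symmetric_def sym_def G_def)
    fix e assume "e \<in> parcs G"
    then show "fst e \<noteq> snd e"
      using no_loop[of "fst e"] by (auto simp: G_def)
  qed (auto simp: G_def)
  interpret pair_graph G by (rule graph)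
  have reach0: "0 \<rightarrow>\<^sup>*\<^bsub>with_proj G\<^esub> v" if "v < n" for v
    using that
  proof (induction v)
    case 0
    then have "0 \<in> pverts G" by (simp add: G_def)
    then show ?case by (rule reachable_refl)
  next
    case (Suc v)
    then have "(v, Suc v) \<in> parcs G" by (auto simp: G_def)
    then show ?case using Suc reachable_adj_trans[of 0 v "Suc v"] by simp
  qed
  have conn: "Digraph_Component.connected (with_proj G)"
    unfolding Digraph_Component.connected_def strongly_connected_def
  proof (intro conjI ballI)
    show "verts (with_proj (mk_symmetric (with_proj G))) \<noteq> {}"
      using n by (simp add: mk_symmetric_def G_def)
    fix u v
    assume "u \<in> verts (with_proj (mk_symmetric (with_proj G)))"
      and "v \<in> verts (with_proj (mk_symmetric (with_proj G)))"
    then have "u < n" "v < n" by (simp_all add: mk_symmetric_def G_def)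
    then have "u \<rightarrow>\<^sup>*\<^bsub>with_proj G\<^esub> 0" "0 \<rightarrow>\<^sup>*\<^bsub>with_proj G\<^esub> v"
      using reach0 symmetric_reachable[OF sym_arcs] by blast+
    then have "u \<rightarrow>\<^sup>*\<^bsub>with_proj G\<^esub> v" by (rule reachable_trans)
    then show "u \<rightarrow>\<^sup>*\<^bsub>with_proj (mk_symmetric (with_proj G))\<^esub> v"
      by (rule reachable_mk_symmetricI)
  qed
  have deg: "out_degree (with_proj G) v = 2" if "v < n" for v
  proof -
    define p where "p = (if v = 0 then n - 1 else v - 1)"
    have p: "p < n" "Suc p mod n = v" using that n by (auto simp: p_def)
    have uniq: "j = p" if j: "j < n" "v = Suc j mod n" for j
    proof (cases "Suc j = n")
      case True
      with j have "v = 0" by simp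
      with True show ?thesis by (simp add: p_def)
    next
      case False
      with j have "v = Suc j" by simp
      then show ?thesis by (simp add: p_def)
    qed
    have "Suc v mod n \<noteq> p"
      using that n by (cases "Suc v = n") (auto simp: p_def)
    moreover have "out_arcs (with_proj G) v = {(v, Suc v mod n), (v, p)}"
    proof -
      have "(v, j) \<in> parcs G \<longleftrightarrow> j = Suc v mod n \<or> j = p" for j
      proof -
        have "Suc v mod n < n" using n by simp
        moreover have "(v, j) \<in> parcs G \<longleftrightarrow> j < n \<and> (j = Suc v mod n \<or> v = Suc j mod n)"
          using that by (simp add: G_def)
        ultimately show ?thesis using p uniq by blast
      qed
      then show ?thesis unfolding out_arcs_def with_proj_simps by force
    qed
    ultimately show ?thesis by (simp add: out_degree_def)
  qed
  have "is_cycle_graph n G"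
    using graph conn deg by (simp add: is_cycle_graph_def) (simp add: G_def)
  then show ?thesis ..
qed

end

theory Submission
  imports Defs "Jordan_Normal_Form.Determinant"
begin

text \<open>
  Enumerate the cycle as \<open>w\<^sub>0, \<dots>, w\<^bsub>n-1\<^esub>\<close>. A kernel vector \<open>y\<close> of \<open>A + D\<close> satisfies
  \<open>y\<^bsub>k+1\<^esub> = - d\<^sub>k y\<^sub>k - y\<^bsub>k-1\<^esub>\<close> cyclically, so it is a fixed vector of a product \<open>M\<close> of transfer
  matrices \<open>T(d) = [[-d, -1], [1, 0]]\<close> of determinant 1; hence \<open>A + D\<close> is singular iff
  \<open>tr M = 2\<close>. Write \<open>M = T(d) N\<close> and let \<open>(a, c)\<close> be the first column of \<open>N\<close>. If
  \<open>a \<noteq> 0\<close>, exactly one \<open>d\<close> gives trace 2; if \<open>a = 0\<close>, then all \<open>d\<close> do when \<open>c = -1\<close>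
  and none otherwise. The same holds for the condition that the upper left entry of \<open>M\<close> is 1, so the
  number of singular operators is \<open>R\<^sub>n(1)\<close>, where \<open>R\<^sub>n(c)\<close> counts the products of length \<open>n\<close>
  with upper left entry \<open>c\<close>. With \<open>s\<^sub>n\<close> the number of products with nonzero upper left entry,
  \<open>R\<^bsub>n+2\<^esub>(c) = s\<^bsub>n+1\<^esub> + q R\<^sub>n(-c)\<close> for \<open>c \<noteq> 0\<close> and \<open>s\<^bsub>n+1\<^esub> + s\<^sub>n = q\<^bsup>n+1\<^esup>\<close>. The sign in
  \<open>R\<^sub>n(-c)\<close> is what separates the residues of \<open>n\<close> modulo 4 in odd characteristic.
\<close>

subsection \<open>Transfer matrices\<close>

text \<open>
  The head of the list acts last, so the matrix of \<open>transfer [d\<^sub>n, \<dots>, d\<^sub>1]\<close> is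
  \<open>T(d\<^sub>n) \<cdots> T(d\<^sub>1)\<close>.
\<close>

primrec transfer :: "'a::field list \<Rightarrow> 'a \<times> 'a \<Rightarrow> 'a \<times> 'a" where
  "transfer [] v = v"
| "transfer (d # ds) v =
     (- d * fst (transfer ds v) - snd (transfer ds v), fst (transfer ds v))"

definition transfer_trace :: "'a::field list \<Rightarrow> 'a" where
  "transfer_trace ds = fst (transfer ds (1, 0)) + snd (transfer ds (0, 1))"

lemma transfer_linear:
  "transfer ds (x, y) =
     (x * fst (transfer ds (1, 0)) + y * fst (transfer ds (0, 1)),
      x * snd (transfer ds (1, 0)) + y * snd (transfer ds (0, 1)))"
  by (induction ds) (auto simp: algebra_simps)

lemma transfer_det:
  "fst (transfer ds (1, 0)) * snd (transfer ds (0, 1))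
   - fst (transfer ds (0, 1)) * snd (transfer ds (1, 0)) = 1"
  by (induction ds) (auto simp: algebra_simps)

text \<open>A matrix \<open>M\<close> of determinant 1 satisfies
  \<open>det (M - I) = 2 - tr M\<close>; this is \<open>charpoly\<close> below.\<close>

lemma transfer_fixpoint_iff:
  fixes ds :: "'a::field list"
  shows "(\<exists>v. v \<noteq> (0, 0) \<and> transfer ds v = v) \<longleftrightarrow> transfer_trace ds = 2"
proof -
  define a b c e where "a = fst (transfer ds (1, 0))" and "b = fst (transfer ds (0, 1))"
    and "c = snd (transfer ds (1, 0))" and "e = snd (transfer ds (0, 1))"
  note defs = a_def b_def c_def e_def
  have lin: "transfer ds (x, y) = (x * a + y * b, x * c + y * e)" for x y
    unfolding defs by (rule transfer_linear)
  have det: "a * e - b * c = 1"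
    unfolding defs by (rule transfer_det)
  have charpoly: "(a - 1) * (e - 1) - b * c = 2 - (a + e)"
    using det by (simp add: algebra_simps)
  show ?thesis
  proof
    assume "\<exists>v. v \<noteq> (0, 0) \<and> transfer ds v = v"
    then obtain x y where nz: "x \<noteq> 0 \<or> y \<noteq> 0" and "transfer ds (x, y) = (x, y)"
      by auto
    then have 1: "x * a + y * b = x" and 2: "x * c + y * e = y"
      by (simp_all add: lin)
    \<comment> \<open>These two identities apply the adjugate of \<open>M - I\<close> to
      \<open>(M - I) v = 0\<close>.\<close>
    have "(2 - (a + e)) * x = (e - 1) * (x * a + y * b - x) - b * (x * c + y * e - y)"
      unfolding charpoly[symmetric] by (simp add: algebra_simps)
    moreover have "(2 - (a + e)) * y = (a - 1) * (x * c + y * e - y) - c * (x * a + y * b - x)"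
      unfolding charpoly[symmetric] by (simp add: algebra_simps)
    ultimately have "(2 - (a + e)) * x = 0" "(2 - (a + e)) * y = 0"
      by (simp_all add: 1 2)
    with nz have "2 - (a + e) = 0" by auto
    then show "transfer_trace ds = 2"
      by (simp add: transfer_trace_def defs)
  next
    assume "transfer_trace ds = 2"
    then have "(a - 1) * (e - 1) - b * c = 0"
      by (simp add: charpoly transfer_trace_def flip: defs)
    then have be: "(a - 1) * (e - 1) = b * c" by simp
    show "\<exists>v. v \<noteq> (0, 0) \<and> transfer ds v = v"
    \<comment> \<open>The vector \<open>(b, 1 - a)\<close> is annihilated by the first row of
      \<open>M - I\<close>, and by the second because the determinant vanishes. It is zero only in
      the other case, where \<open>det\<close> forces \<open>e = 1\<close>.\<close>
    proof (cases "b = 0 \<and> a = 1")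
      case False
      have "b * c + (1 - a) * e = 1 - a"
        using be by (simp add: algebra_simps)
      then have "transfer ds (b, 1 - a) = (b, 1 - a)"
        by (simp add: lin algebra_simps)
      then show ?thesis using False by (intro exI[of _ "(b, 1 - a)"]) auto
    next
      case True
      then have "transfer ds (0, 1) = (0, 1)" using det by (simp add: lin)
      then show ?thesis by (intro exI[of _ "(0, 1)"]) auto
    qed
  qed
qed

lemma transfer_zero: "transfer ds (0, 0) = (0, 0)"
  by (induction ds) auto

text \<open>The state after \<open>k\<close> steps is the pair of \<open>y k\<close> and its cyclic
  predecessor, so periodic solutions are exactly the orbits that return to their initial state after
  \<open>n\<close> steps.\<close>

lemma cyclic_recurrence_solvable_iff:
  fixes e :: "nat \<Rightarrow> 'a::field"
  assumes n: "n \<ge> 1"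
  shows "(\<exists>y. (\<exists>k<n. y k \<noteq> 0) \<and>
            (\<forall>k<n. y (Suc k mod n) + y ((k + n - 1) mod n) + e k * y k = 0)) \<longleftrightarrow>
         transfer_trace (map e (rev [0..<n])) = 2"
    (is "?L \<longleftrightarrow> _")
proof -
  define T where "T k = transfer (map e (rev [0..<k]))" for k
  have T0: "T 0 v = v" for v by (simp add: T_def)
  have TS: "T (Suc k) v = (- e k * fst (T k v) - snd (T k v), fst (T k v))" for k v
    by (simp add: T_def)
  have "?L \<longleftrightarrow> (\<exists>v. v \<noteq> (0, 0) \<and> T n v = v)"
  proof
    assume ?L
    then obtain y where nz: "\<exists>k<n. y k \<noteq> 0"
      and rec: "\<And>k. k < n \<Longrightarrow> y (Suc k mod n) + y ((k + n - 1) mod n) + e k * y k = 0"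
      by blast
    define v where "v = (y 0, y (n - 1))"
    have T: "T k v = (y (k mod n), y ((k + n - 1) mod n))" if "k \<le> n" for k
      using that
    proof (induction k)
      case 0
      then show ?case using n by (simp add: T0 v_def)
    next
      case (Suc k)
      have "y (Suc k mod n) = - e k * y k - y ((k + n - 1) mod n)"
        using rec[of k] Suc.prems by (simp add: eq_neg_iff_add_eq_0 algebra_simps)
      then show ?case using Suc by (simp add: TS)
    qed
    have "v \<noteq> (0, 0)"
    proof
      assume "v = (0, 0)"
      then have "y k = 0" if "k < n" for k
        using T[of k] that transfer_zero by (metis T_def fst_conv less_imp_le mod_less)
      with nz show False by blast
    qed
    moreover have "(n + n - 1) mod n = n - 1"
      using n by (metis Nat.add_diff_assoc diff_less less_numeral_extra(1) mod_add_self1 mod_less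
          order_less_le_trans)
    then have "T n v = v" using T[of n] by (simp add: v_def)
    ultimately show "\<exists>v. v \<noteq> (0, 0) \<and> T n v = v" by blast
  next
    assume "\<exists>v. v \<noteq> (0, 0) \<and> T n v = v"
    then obtain v where v: "v \<noteq> (0, 0)" "T n v = v" by blast
    \<comment> \<open>The second coordinate of a state is the previous first coordinate;
      \<open>T n v = v\<close> closes this sequence up cyclically.\<close>
    define y where "y k = fst (T k v)" for k
    have snd: "snd (T (Suc k) v) = y k" for k by (simp add: TS y_def)
    have wrap: "snd v = y (n - 1)" "y n = y 0"
      using snd[of "n - 1"] n v(2) by (simp_all add: y_def T0)
    have next_eq: "y (Suc k mod n) = y (Suc k)" if "k < n" for k
      using that wrap by (cases "Suc k = n") auto
    have prev_eq: "y ((k + n - 1) mod n) = snd (T k v)" if "k < n" for k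
    proof (cases k)
      case 0
      then show ?thesis using n wrap by (simp add: T0)
    next
      case (Suc j)
      then show ?thesis using that snd[of j] by simp
    qed
    have "y (Suc k mod n) + y ((k + n - 1) mod n) + e k * y k = 0" if "k < n" for k
      unfolding next_eq[OF that] prev_eq[OF that] by (simp add: y_def TS)
    moreover have "\<exists>k<n. y k \<noteq> 0"
    proof (rule ccontr)
      assume "\<not> (\<exists>k<n. y k \<noteq> 0)"
      then have "y 0 = 0" "y (n - 1) = 0" using n by auto
      with wrap have "v = (0, 0)" by (simp add: y_def T0 prod_eq_iff)
      with v show False by simp
    qed
    ultimately show ?L by blast
  qed
  then show ?thesis unfolding T_def by (simp only: transfer_fixpoint_iff)
qed

subsection \<open>Counting products of transfer matrices\<close>

lemma finite_lists_length [simp]: "finite {ds :: 'a::finite list. length ds = m}"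
  using finite_lists_length_eq[of "UNIV :: 'a set" m] by simp

text \<open>Fixing the tail and counting admissible heads is the basis of all recursions
  below.\<close>

lemma card_lists_length_Suc_Collect:
  fixes P :: "'a::finite list \<Rightarrow> bool"
  shows "card {ds. length ds = Suc m \<and> P ds} =
    (\<Sum>ds | length ds = m. card {d. P (d # ds)})"
proof -
  have "{ds. length ds = Suc m \<and> P ds} =
      (\<lambda>(ds, d). d # ds) ` (SIGMA ds:{ds. length ds = m}. {d. P (d # ds)})"
    by (auto simp: length_Suc_conv image_iff)
  also have "card \<dots> = card (SIGMA ds:{ds. length ds = m}. {d. P (d # ds)})"
    by (rule card_image) (auto simp: inj_on_def)
  also have "\<dots> = (\<Sum>ds | length ds = m. card {d. P (d # ds)})"
    by (simp add: card_SigmaI)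
  finally show ?thesis .
qed

text \<open>
  The first coordinate of \<open>transfer ds (1, 0)\<close> is, up to sign, the continuant of \<open>ds\<close>.
\<close>

definition continuant_count :: "nat \<Rightarrow> 'a::{field,finite} \<Rightarrow> nat" where
  "continuant_count m c = card {ds. length ds = m \<and> fst (transfer ds (1, 0)) = c}"

definition nonzero_continuant_count :: "'a::{field,finite} itself \<Rightarrow> nat \<Rightarrow> nat" where
  "nonzero_continuant_count _ m =
     card {ds :: 'a list. length ds = m \<and> fst (transfer ds (1, 0)) \<noteq> 0}"

lemma card_lists_length: "card {ds :: 'a::finite list. length ds = m} = CARD('a) ^ m"
  using card_lists_length_eq[of "UNIV :: 'a set" m] by simp

lemma sum_indicator_lists:
  fixes P :: "'a::finite list \<Rightarrow> bool"
  shows "(\<Sum>ds | length ds = m. if P ds then k else 0) = k * card {ds. length ds = m \<and> P ds}"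
  by (simp add: sum.If_cases Collect_conj_eq[symmetric] Int_def mult.commute)

text \<open>For \<open>a = 0\<close> the equation no longer involves \<open>d\<close>. Writing the
  result as a sum of two indicators lets a sum over tails split into two counts.\<close>

lemma card_solutions_affine:
  fixes a b :: "'a::{field,finite}"
  shows "card {d. - d * a - b = c} =
    (if a \<noteq> 0 then 1 else 0) + (if a = 0 \<and> b = - c then CARD('a) else 0)"
proof (cases "a = 0")
  case True
  then show ?thesis by (auto simp: minus_equation_iff)
next
  case False
  then have "{d. - d * a - b = c} = {- (b + c) / a}"
    by (auto simp: field_simps) (metis add_diff_cancel_left' add_minus_cancel diff_eq_eq minus_diff_eq)
  then show ?thesis using False by simp
qed

text \<open>A tail with nonzero upper left entry admits one head; a tail with first column
  \<open>(0, - c)\<close> admits every head.\<close>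

lemma continuant_count_Suc:
  fixes c :: "'a::{field,finite}"
  shows "continuant_count (Suc m) c = nonzero_continuant_count TYPE('a) m +
    CARD('a) * card {ds :: 'a list. length ds = m \<and> transfer ds (1, 0) = (0, - c)}"
  unfolding continuant_count_def nonzero_continuant_count_def
    card_lists_length_Suc_Collect transfer.simps fst_conv card_solutions_affine
    sum.distrib sum_indicator_lists by (simp add: prod_eq_iff)

text \<open>The new second coordinate is the old first one, so the tail must have first coordinate
  \<open>z\<close>; as \<open>z\<close> is nonzero, exactly one head then cancels the new first
  coordinate.\<close>

lemma card_transfer_eq_Suc:
  fixes z :: "'a::{field,finite}"
  assumes z: "z \<noteq> 0"
  shows "card {ds :: 'a list. length ds = Suc m \<and> transfer ds (1, 0) = (0, z)} =
    continuant_count m z"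
proof -
  have "card {d. transfer (d # ds) (1, 0) = (0, z)} =
      (if fst (transfer ds (1, 0)) = z then 1 else 0)" for ds :: "'a list"
  proof (cases "fst (transfer ds (1, 0)) = z")
    case True
    then have "{d. transfer (d # ds) (1, 0) = (0, z)} =
        {d. - d * fst (transfer ds (1, 0)) - snd (transfer ds (1, 0)) = 0}"
      by simp
    then show ?thesis using True z by (simp only: card_solutions_affine) simp
  qed simp
  then show ?thesis
    unfolding continuant_count_def card_lists_length_Suc_Collect
    by (simp only: sum_indicator_lists mult_1)
qed

lemma continuant_count_add_2:
  fixes c :: "'a::{field,finite}"
  assumes "c \<noteq> 0"
  shows "continuant_count (m + 2) c =
    nonzero_continuant_count TYPE('a) (m + 1) + CARD('a) * continuant_count m (- c)"
  using continuant_count_Suc[of "Suc m" c] card_transfer_eq_Suc[of "- c" m] assms by simp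

lemma nonzero_continuant_count_0: "nonzero_continuant_count TYPE('a::{field,finite}) 0 = 1"
proof -
  have "{ds :: 'a list. length ds = 0 \<and> fst (transfer ds (1, 0)) \<noteq> 0} = {[]}" by auto
  then show ?thesis by (simp add: nonzero_continuant_count_def)
qed

lemma continuant_count_0:
  "continuant_count 0 (c :: 'a::{field,finite}) = (if c = 1 then 1 else 0)"
proof -
  have "{ds :: 'a list. length ds = 0 \<and> fst (transfer ds (1, 0)) = c} = (if c = 1 then {[]} else {})"
    by auto
  then show ?thesis by (simp add: continuant_count_def)
qed

lemma continuant_count_1: "continuant_count 1 (c :: 'a::{field,finite}) = 1"
proof -
  have "{ds :: 'a list. length ds = 0 \<and> transfer ds (1, 0) = (0, - c)} = {}" by auto
  then show ?thesis
    using continuant_count_Suc[of 0 c] by (simp only: nonzero_continuant_count_0) simp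
qed

text \<open>Exactly one head makes the upper left entry vanish if that of the tail is nonzero. If it
  is zero, determinant 1 makes the lower left entry nonzero, and no head works.\<close>

lemma nonzero_continuant_count_Suc:
  "nonzero_continuant_count TYPE('a::{field,finite}) (Suc m) +
   nonzero_continuant_count TYPE('a) m = CARD('a) ^ Suc m"
proof -
  have vanish: "card {d. fst (transfer (d # ds) (1, 0)) = 0} =
      (if fst (transfer ds (1, 0)) \<noteq> 0 then 1 else 0)" for ds :: "'a list"
    using transfer_det[of ds] unfolding transfer.simps fst_conv card_solutions_affine by auto
  have "card {ds :: 'a list. length ds = Suc m \<and> fst (transfer ds (1, 0)) = 0} =
      nonzero_continuant_count TYPE('a) m"
    unfolding card_lists_length_Suc_Collect vanish sum_indicator_lists
    by (simp add: nonzero_continuant_count_def)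
  moreover have "card {ds :: 'a list. length ds = Suc m} =
      card {ds :: 'a list. length ds = Suc m \<and> fst (transfer ds (1, 0)) \<noteq> 0} +
      card {ds :: 'a list. length ds = Suc m \<and> fst (transfer ds (1, 0)) = 0}"
    by (subst card_Un_disjoint[symmetric])
       (auto intro: finite_subset[OF _ finite_lists_length[of "Suc m"]] intro!: arg_cong[of _ _ card])
  ultimately show ?thesis
    by (simp add: card_lists_length nonzero_continuant_count_def)
qed

lemma nonzero_continuant_count_closed:
  "(real CARD('a::{field,finite}) + 1) * real (nonzero_continuant_count TYPE('a) m) =
     real CARD('a) ^ (m + 1) + (-1) ^ m"
proof (induction m)
  case 0
  then show ?case by (simp add: nonzero_continuant_count_0)
next
  case (Suc m)
  let ?q = "real CARD('a)"
  have "real (nonzero_continuant_count TYPE('a) (Suc m)) =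
      ?q ^ Suc m - real (nonzero_continuant_count TYPE('a) m)"
    using arg_cong[OF nonzero_continuant_count_Suc[of m, where ?'a = 'a], of real] by simp
  then have "(?q + 1) * real (nonzero_continuant_count TYPE('a) (Suc m)) =
      (?q + 1) * ?q ^ Suc m - (?q + 1) * real (nonzero_continuant_count TYPE('a) m)"
    by (simp only: right_diff_distrib)
  then show ?case using Suc by (simp add: algebra_simps)
qed

text \<open>
  The two conditions differ, but once the tail of the list is fixed, both are affine equations
  in the head with the same number of solutions, because the tail has determinant 1.
\<close>

lemma card_trace_eq_2:
  "card {ds :: 'a::{field,finite} list. length ds = Suc m \<and> transfer_trace ds = 2} =
   continuant_count (Suc m) (1 :: 'a)"
proof -
  have "card {d. transfer_trace (d # ds) = 2} = card {d. fst (transfer (d # ds) (1, 0)) = 1}"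
    for ds :: "'a list"
  proof -
    define a b c where "a = fst (transfer ds (1, 0))" and "b = fst (transfer ds (0, 1))"
      and "c = snd (transfer ds (1, 0))"
    note defs = a_def b_def c_def
    have "{d. transfer_trace (d # ds) = 2} = {d. - d * a - (c - b) = 2}"
      by (simp add: transfer_trace_def algebra_simps flip: defs)
    \<comment> \<open>With \<open>a = 0\<close> the determinant gives \<open>b * c = -1\<close>, so
      \<open>b = c + 2\<close> means \<open>(c + 1) * (c + 1) = 0\<close>, in every
      characteristic.\<close>
    moreover have "c - b = -2 \<longleftrightarrow> c = -1" if "a = 0"
    proof -
      have bc: "- (b * c) = 1" using transfer_det[of ds] that by (simp flip: defs)
      show ?thesis
      proof
        assume "c - b = -2"
        then have "b = c + 2" by (simp add: algebra_simps)
        moreover have "(c + 1) * (c + 1) = 1 + (c + 2) * c" by (simp add: algebra_simps)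
        ultimately have "(c + 1) * (c + 1) = 0" using bc by (metis add.left_inverse)
        then show "c = -1" by (simp add: eq_neg_iff_add_eq_0)
      next
        assume "c = -1"
        with bc show "c - b = -2" by simp
      qed
    qed
    ultimately show ?thesis
      unfolding transfer.simps fst_conv
      by (simp only: card_solutions_affine flip: defs) auto
  qed
  then show ?thesis
    unfolding continuant_count_def card_lists_length_Suc_Collect by simp
qed

section \<open>Closed forms of the continuant counts\<close>

lemma one_less_card_field: "1 < CARD('a::{field,finite})"
proof -
  have "card {0, 1 :: 'a} \<le> CARD('a)" by (rule card_mono) auto
  then show ?thesis by simp
qed

text \<open>The two-step recursion replaces \<open>c\<close> by \<open>- c\<close>, hence the
  induction over all nonzero \<open>c\<close>. The base value at length 1 is independent of
  \<open>c\<close>, so no sign survives.\<close>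

lemma continuant_count_odd_closed:
  fixes c :: "'a::{field,finite}"
  assumes "c \<noteq> 0"
  shows "real (continuant_count (2 * k + 1) c) =
    (1 - real CARD('a) ^ (2 * k + 2)) / (1 - real CARD('a) ^ 2)"
  using assms
proof (induction k arbitrary: c)
  case 0
  have "real CARD('a) ^ 2 \<noteq> 1"
    using one_less_card_field[where ?'a = 'a] by (simp add: power2_eq_1_iff)
  then show ?case using continuant_count_1[of c] by (simp add: power2_eq_square)
next
  case (Suc k)
  define q where "q = real CARD('a)"
  have q: "q > 1" using one_less_card_field[where ?'a = 'a] by (simp add: q_def)
  then have q2: "1 - q ^ 2 \<noteq> 0" "q + 1 \<noteq> 0" by (auto simp: power2_eq_1_iff)
  define s where "s = real (nonzero_continuant_count TYPE('a) (2 * k + 1 + 1))"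
  have s: "(q + 1) * s = q ^ (2 * k + 3) + 1"
    using nonzero_continuant_count_closed[of "2 * k + 2", where ?'a = 'a]
    by (simp add: s_def q_def numeral_3_eq_3)
  define r where "r = real (continuant_count (2 * k + 1) (- c))"
  have r: "(1 - q ^ 2) * r = 1 - q ^ (2 * k + 2)"
    using Suc.IH[of "- c"] Suc.prems q2 by (simp add: r_def flip: q_def)
  have rec: "real (continuant_count (2 * Suc k + 1) c) = s + q * r"
    using arg_cong[OF continuant_count_add_2[OF Suc.prems, of "2 * k + 1"], of real]
    by (simp add: s_def r_def q_def)
  \<comment> \<open>Since \<open>1 - q ^ 2 = (1 - q) * (q + 1)\<close>, this factor clears the
    denominators of both \<open>s\<close> and \<open>r\<close>.\<close>
  have "(1 - q ^ 2) * (s + q * r) = (1 - q) * ((q + 1) * s) + q * ((1 - q ^ 2) * r)"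
    by (simp add: algebra_simps power2_eq_square)
  also have "\<dots> = 1 - q ^ (2 * Suc k + 2)"
    unfolding s r by (simp add: algebra_simps eval_nat_numeral)
  finally show ?case
    unfolding rec q_def[symmetric] using q2 by (simp add: nonzero_eq_divide_eq mult.commute)
qed

text \<open>At length 0 the count is the indicator of \<open>c = 1\<close>. Each double step
  multiplies this part by the field order and negates its support, giving the power at
  \<open>c = (-1) ^ k\<close>.\<close>

lemma continuant_count_even_closed:
  fixes c :: "'a::{field,finite}"
  assumes "c \<noteq> 0"
  shows "real (continuant_count (2 * k) c) =
    (if c = (-1) ^ k then real CARD('a) ^ k else 0)
    - (1 - real CARD('a) ^ k) * (1 - real CARD('a) ^ (k + 1)) / (1 - real CARD('a) ^ 2)"
  using assms
proof (induction k arbitrary: c)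
  case 0
  then show ?case by (simp add: continuant_count_0)
next
  case (Suc k)
  define q where "q = real CARD('a)"
  have q: "q > 1" using one_less_card_field[where ?'a = 'a] by (simp add: q_def)
  then have q2: "1 - q ^ 2 \<noteq> 0" "q + 1 \<noteq> 0" by (auto simp: power2_eq_1_iff)
  define s where "s = real (nonzero_continuant_count TYPE('a) (2 * k + 1))"
  have s: "(q + 1) * s = q ^ (2 * k + 2) - 1"
    using nonzero_continuant_count_closed[of "2 * k + 1", where ?'a = 'a]
    by (simp add: s_def q_def)
  \<comment> \<open>The indicator part of the induction hypothesis at \<open>- c\<close> is split
    off, so that \<open>r\<close> is a single fraction.\<close>
  define i where "i = (if c = (-1) ^ Suc k then q ^ k else 0)"
  define r where "r = real (continuant_count (2 * k) (- c)) - i"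
  have "(- c = (-1) ^ k) = (c = (-1) ^ Suc k)" by (metis minus_equation_iff power_Suc mult_minus1)
  then have "r = - ((1 - q ^ k) * (1 - q ^ (k + 1)) / (1 - q ^ 2))"
    using Suc.IH[of "- c"] Suc.prems by (simp add: r_def i_def flip: q_def)
  then have r: "(1 - q ^ 2) * r = - ((1 - q ^ k) * (1 - q ^ (k + 1)))"
    using q2 by simp
  have rec: "real (continuant_count (2 * Suc k) c) = s + q * (r + i)"
    using arg_cong[OF continuant_count_add_2[OF Suc.prems, of "2 * k"], of real]
    by (simp add: s_def r_def q_def)
  have "(1 - q ^ 2) * (s + q * r) = (1 - q) * ((q + 1) * s) + q * ((1 - q ^ 2) * r)"
    by (simp add: algebra_simps power2_eq_square)
  also have "\<dots> = - ((1 - q ^ Suc k) * (1 - q ^ (Suc k + 1)))"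
    unfolding s r by (simp add: algebra_simps power_add power_mult power2_eq_square power_mult_distrib)
  finally have "s + q * r = - ((1 - q ^ Suc k) * (1 - q ^ (Suc k + 1))) / (1 - q ^ 2)"
    unfolding nonzero_eq_divide_eq[OF q2(1)] by (simp only: mult.commute)
  moreover have "q * i = (if c = (-1) ^ Suc k then q ^ Suc k else 0)"
    by (simp add: i_def)
  ultimately show ?case
    unfolding rec q_def[symmetric] by (simp add: distrib_left)
qed

section \<open>Parity of the order of a finite field\<close>

lemma of_nat_card_eq_0: "of_nat CARD('a::{field,finite}) = (0 :: 'a)"
proof -
  \<comment> \<open>Translation by 1 permutes the field but adds as many ones as there are
    elements.\<close>
  have "(\<Sum>x\<in>UNIV. x + 1) = (\<Sum>x\<in>UNIV. x :: 'a)"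
    by (rule sum.reindex_bij_betw) (rule bij_betw_byWitness[of _ "\<lambda>x. x - 1"], auto)
  then show ?thesis by (simp add: sum.distrib)
qed

text \<open>Multiplication by \<open>a\<close> permutes the nonzero elements, so it preserves their
  product.\<close>

lemma power_card_minus_1_eq_1:
  fixes a :: "'a::{field,finite}"
  assumes a: "a \<noteq> 0"
  shows "a ^ (CARD('a) - 1) = 1"
proof -
  have "bij_betw ((*) a) (UNIV - {0}) (UNIV - {0})"
    using a by (intro bij_betw_byWitness[of _ "\<lambda>x. x / a"]) auto
  then have "(\<Prod>x\<in>UNIV - {0}. a * x) = (\<Prod>x\<in>UNIV - {0}. x)"
    by (rule prod.reindex_bij_betw)
  moreover have "(\<Prod>x\<in>UNIV - {0 :: 'a}. x) \<noteq> 0" by simp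
  ultimately show ?thesis by (simp add: prod.distrib card_Diff_singleton)
qed

text \<open>For even order, -1 raised to the odd exponent \<open>CARD('a) - 1\<close> equals 1.
  Conversely, if 2 vanishes, an odd order would be 1 in the field rather than 0.\<close>

lemma even_card_field_iff: "even CARD('a::{field,finite}) \<longleftrightarrow> (- 1 :: 'a) = 1"
proof
  assume "even CARD('a)"
  then have "odd (CARD('a) - 1)" using one_less_card_field[where ?'a = 'a] by simp
  then show "(- 1 :: 'a) = 1" using power_card_minus_1_eq_1[of "- 1 :: 'a"] by simp
next
  assume char: "(- 1 :: 'a) = 1"
  show "even CARD('a)"
  proof (rule ccontr)
    assume "odd CARD('a)"
    then obtain k where "CARD('a) = 2 * k + 1" by (rule oddE)
    then have "(0 :: 'a) = of_nat (2 * k + 1)" using of_nat_card_eq_0[where ?'a = 'a] by simp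
    moreover have "(2 :: 'a) = 0" using char by (metis add.right_inverse one_add_one)
    ultimately show False by simp
  qed
qed

subsection \<open>Connected two-regular graphs\<close>

lemma nonbacktracking_walk_exists:
  fixes N :: "'v \<Rightarrow> 'v set"
  assumes card2: "\<And>v. v \<in> V \<Longrightarrow> card (N v) = 2"
    and sub: "\<And>v. v \<in> V \<Longrightarrow> N v \<subseteq> V"
    and v0: "v0 \<in> V"
  obtains w where "w 0 = v0" "\<And>k. w k \<in> V" "\<And>k. w (Suc k) \<in> N (w k)"
    "\<And>k. w (Suc (Suc k)) \<noteq> w k"
proof -
  have other: "\<exists>y. y \<in> N v \<and> y \<noteq> u" if "v \<in> V" for u v
    using card2[OF that] by (metis card_2_iff')
  \<comment> \<open>The state is a directed edge: current vertex and next vertex. The clause for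
    \<open>k = 0\<close> fixes the start within the invariant.\<close>
  have "\<exists>f. \<forall>k. (fst (f k) \<in> V \<and> snd (f k) \<in> N (fst (f k)) \<and> (k = 0 \<longrightarrow> fst (f k) = v0)) \<and>
      (fst (f (Suc k)) = snd (f k) \<and> snd (f (Suc k)) \<noteq> fst (f k))"
  proof (rule dependent_nat_choice)
    show "\<exists>x. fst x \<in> V \<and> snd x \<in> N (fst x) \<and> (0 = 0 \<longrightarrow> fst x = v0)"
      using other[OF v0] v0 by (metis fst_conv snd_conv)
  next
    fix x :: "'v \<times> 'v" and k :: nat
    assume "fst x \<in> V \<and> snd x \<in> N (fst x) \<and> (k = 0 \<longrightarrow> fst x = v0)"
    then have "snd x \<in> V" using sub by blast
    moreover obtain y where "y \<in> N (snd x)" "y \<noteq> fst x" using other calculation by blast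
    ultimately show "\<exists>y. (fst y \<in> V \<and> snd y \<in> N (fst y) \<and> (Suc k = 0 \<longrightarrow> fst y = v0)) \<and>
        fst y = snd x \<and> snd y \<noteq> fst x"
      by (intro exI[of _ "(snd x, y)"]) simp
  qed
  then obtain f where f: "\<And>k. fst (f k) \<in> V" "\<And>k. snd (f k) \<in> N (fst (f k))" "fst (f 0) = v0"
    "\<And>k. fst (f (Suc k)) = snd (f k)" "\<And>k. snd (f (Suc k)) \<noteq> fst (f k)"
    by metis
  show thesis
    by (rule that[of "\<lambda>k. fst (f k)"]) (use f in auto)
qed

text \<open>A non-backtracking walk in a finite set must repeat a vertex, and its first repetition
  closes a cycle containing all neighbours of its vertices. By \<open>conn\<close>, which states
  connectedness through closed sets, this cycle is everything.\<close>

lemma two_regular_connected_enum: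
  fixes N :: "'v \<Rightarrow> 'v set"
  assumes fin: "finite V" and ne: "V \<noteq> {}"
    and card2: "\<And>v. v \<in> V \<Longrightarrow> card (N v) = 2"
    and sub: "\<And>v. v \<in> V \<Longrightarrow> N v \<subseteq> V"
    and sym: "\<And>u v. u \<in> V \<Longrightarrow> v \<in> N u \<Longrightarrow> u \<in> N v"
    and irrefl: "\<And>v. v \<in> V \<Longrightarrow> v \<notin> N v"
    and conn: "\<And>W. W \<subseteq> V \<Longrightarrow> W \<noteq> {} \<Longrightarrow> (\<And>v. v \<in> W \<Longrightarrow> N v \<subseteq> W) \<Longrightarrow> W = V"
  obtains w where "bij_betw w {0..<card V} V"
    "\<And>k. k < card V \<Longrightarrow> N (w k) = {w (Suc k mod card V), w ((k + card V - 1) mod card V)}"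
    "\<And>k. k < card V \<Longrightarrow> w (Suc k mod card V) \<noteq> w ((k + card V - 1) mod card V)"
proof -
  obtain v0 where "v0 \<in> V" using ne by blast
  then obtain w where wV: "\<And>k. w k \<in> V" and adj: "\<And>k. w (Suc k) \<in> N (w k)"
    and nb: "\<And>k. w (Suc (Suc k)) \<noteq> w k"
    using nonbacktracking_walk_exists[of V N v0] card2 sub by metis
  have pair: "N v = {x, y}" if "v \<in> V" "x \<in> N v" "y \<in> N v" "x \<noteq> y" for v x y
  proof -
    have "finite (N v)" using card2[OF that(1)] by (metis card.infinite zero_neq_numeral)
    then have "{x, y} = N v" using card2[OF that(1)] that by (intro card_subset_eq) auto
    then show ?thesis ..
  qed
  have adj_back: "w k \<in> N (w (Suc k))" for k using sym[OF wV adj] .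
  have N_Suc: "N (w (Suc k)) = {w (Suc (Suc k)), w k}" for k
    using pair[OF wV adj adj_back] nb by blast
  have step_ne: "w (Suc k) \<noteq> w k" for k using irrefl[OF wV] adj by metis

  \<comment> \<open>The first vertex visited twice is the starting vertex: any other visited vertex already has
    its two neighbours on the walk, so that its predecessor would be repeated earlier.\<close>
  define repeats where "repeats j \<longleftrightarrow> (\<exists>i<j. w j = w i)" for j
  have "\<not> inj w"
    using fin wV by (metis finite_subset image_subsetI infinite_UNIV_nat finite_imageD)
  then obtain a b where "a \<noteq> b" "w a = w b" by (auto simp: inj_def)
  then have "\<exists>j. repeats j" unfolding repeats_def by (metis linorder_neqE_nat)
  then obtain j where j: "repeats j" and least: "\<And>l. l < j \<Longrightarrow> \<not> repeats l"
    by (metis exists_least_iff)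
  then obtain i where ij: "i < j" "w j = w i" by (auto simp: repeats_def)
  have inj: "k = l" if "k < j" "l < j" "w k = w l" for k l
    using that least[of k] least[of l] unfolding repeats_def by (metis linorder_neqE_nat)
  obtain j' where j': "j = Suc j'" using ij by (cases j) auto
  \<comment> \<open>Irreflexivity rules out a return after one step, non-backtracking after
    two.\<close>
  have "j \<noteq> Suc i" using ij step_ne[of i] by auto
  moreover have "j \<noteq> Suc (Suc i)" using ij nb[of i] by auto
  ultimately have ij3: "i + 3 \<le> j" using ij by simp
  have mem: "w j' \<in> N (w i)" using adj_back[of j'] ij j' by simp
  have "i = 0"
  proof (rule ccontr)
    assume "i \<noteq> 0"
    then obtain i' where i': "i = Suc i'" by (cases i) auto
    have "w j' = w (Suc i) \<or> w j' = w i'" using mem N_Suc[of i'] i' by auto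
    then show False using inj[of j' "Suc i"] inj[of j' i'] ij3 i' j' by auto
  qed
  then have w_j: "w j = w 0" and j3: "3 \<le> j" using ij ij3 by auto
  have "w 1 \<noteq> w j'" using inj[of 1 j'] j3 j' by auto
  then have N0: "N (w 0) = {w 1, w j'}"
    using mem \<open>i = 0\<close> adj[of 0] by (intro pair[OF wV]) auto
  have nbrs: "N (w k) = {w (Suc k mod j), w ((k + j - 1) mod j)}" if "k < j" for k
  proof (cases k)
    case 0
    then show ?thesis using N0 j3 j' by simp
  next
    case (Suc l)
    have "w (Suc k mod j) = w (Suc k)" using w_j that by (cases "Suc k = j") auto
    then show ?thesis using N_Suc[of l] Suc that by simp
  qed
  have distinct: "w (Suc k mod j) \<noteq> w ((k + j - 1) mod j)" if "k < j" for k
    using card2[OF wV[of k]] nbrs[OF that] by auto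
  have "w ` {0..<j} = V"
  proof (rule conn)
    show "w ` {0..<j} \<subseteq> V" using wV by auto
    show "w ` {0..<j} \<noteq> {}" using j3 by auto
    show "N v \<subseteq> w ` {0..<j}" if "v \<in> w ` {0..<j}" for v
      using that nbrs j3 by auto
  qed
  moreover have "inj_on w {0..<j}" using inj by (auto simp: inj_on_def)
  ultimately have "bij_betw w {0..<j} V" and "card V = j"
    by (auto simp: bij_betw_def card_image)
  then show thesis using that[of w] nbrs distinct by simp
qed

text \<open>A nonempty set closed under neighbours contains all vertices reachable from it, so
  connectedness of \<open>G\<close> supplies the closed-set form used above.\<close>

lemma cycle_graph_enum:
  assumes G: "is_cycle_graph n G" and n: "n \<ge> 1"
  obtains w where "bij_betw w {0..<n} {0..<n}"
    "\<And>k. k < n \<Longrightarrow> {j. (w k, j) \<in> parcs G} = {w (Suc k mod n), w ((k + n - 1) mod n)}"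
    "\<And>k. k < n \<Longrightarrow> w (Suc k mod n) \<noteq> w ((k + n - 1) mod n)"
proof -
  interpret pair_graph G using G by (simp add: is_cycle_graph_def)
  have V: "pverts G = {0..<n}" using G by (simp add: is_cycle_graph_def)
  define N where "N v = {j. (v, j) \<in> parcs G}" for v
  have "card (N v) = 2" if "v \<in> {0..<n}" for v
  proof -
    have "out_arcs (with_proj G) v = Pair v ` N v"
      by (auto simp: out_arcs_def N_def)
    moreover have "card (Pair v ` N v) = card (N v)" by (rule card_image) (simp add: inj_on_def)
    moreover have "out_degree (with_proj G) v = 2"
      using G that by (simp add: is_cycle_graph_def)
    ultimately show ?thesis by (simp add: out_degree_def)
  qed
  moreover have "N v \<subseteq> {0..<n}" for v
    using in_arcsD2 V by (auto simp: N_def)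
  moreover have "u \<in> N v" if "v \<in> N u" for u v
    using that sym_arcs by (auto simp: N_def symmetric_def sym_def)
  moreover have "v \<notin> N v" for v
    using no_loops[of "(v, v)"] by (auto simp: N_def)
  moreover have "W = {0..<n}" if "W \<subseteq> {0..<n}" "W \<noteq> {}" and closed: "\<And>v. v \<in> W \<Longrightarrow> N v \<subseteq> W" for W
  proof -
    obtain u where u: "u \<in> W" using \<open>W \<noteq> {}\<close> by blast
    have "v \<in> W" if "v < n" for v
    proof -
      have "u \<in> pverts G" "v \<in> pverts G" using u \<open>W \<subseteq> {0..<n}\<close> \<open>v < n\<close> V by auto
      then have "u \<rightarrow>\<^sup>*\<^bsub>with_proj (mk_symmetric (with_proj G))\<^esub> v"
        using G by (auto simp: is_cycle_graph_def Digraph_Component.connected_def strongly_connected_def)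
      then have "u \<rightarrow>\<^sup>*\<^bsub>with_proj G\<^esub> v"
        using reachable_mk_symmetric_eq[OF sym_arcs] by blast
      then show "v \<in> W"
      proof (induction rule: reachable_induct)
        case base
        then show ?case using u by simp
      next
        case (step x y)
        then show ?case using closed[of x] by (auto simp: N_def)
      qed
    qed
    then show ?thesis using \<open>W \<subseteq> {0..<n}\<close> by auto
  qed
  ultimately show thesis
    using two_regular_connected_enum[of "{0..<n}" N] n that unfolding N_def
    by (simp, metis)
qed

subsection \<open>Schroedinger operators\<close>

lemma invertible_mat_iff_kernel_trivial:
  fixes A :: "'a::field mat"
  assumes A: "A \<in> carrier_mat n n"
  shows "invertible_mat A \<longleftrightarrow> \<not> (\<exists>v. v \<in> carrier_vec n \<and> v \<noteq> 0\<^sub>v n \<and> A *\<^sub>v v = 0\<^sub>v n)"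
proof -
  have "invertible_mat A \<longleftrightarrow> det A \<noteq> 0"
  proof
    assume "invertible_mat A"
    then obtain B where B: "A * B = 1\<^sub>m n" "B * A = 1\<^sub>m (dim_row B)"
      using A by (auto simp: invertible_mat_def inverts_mat_def)
    \<comment> \<open>The shape of the inverse is read off from the dimensions of the two
      products.\<close>
    have "dim_col B = n" using arg_cong[OF B(1), of dim_col] by simp
    moreover have "dim_row B = n" using arg_cong[OF B(2), of dim_col] A by simp
    ultimately have "B \<in> carrier_mat n n" by auto
    then have "det A * det B = 1" using det_mult[OF A] B(1) by (metis det_one)
    then show "det A \<noteq> 0" by auto
  next
    assume "det A \<noteq> 0"
    from det_non_zero_imp_unit[OF A this, of "()"] obtain B
      where "B \<in> carrier_mat n n" "A * B = 1\<^sub>m n" "B * A = 1\<^sub>m n"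
      by (auto simp: Units_def ring_mat_def)
    then show "invertible_mat A"
      using A by (auto simp: invertible_mat_def inverts_mat_def)
  qed
  then show ?thesis using det_0_iff_vec_prod_zero_field[OF A] by simp
qed

lemma schroedinger_mult_vec_index:
  fixes D :: "'a::field mat"
  assumes V: "pverts G = {0..<n}" and D: "D \<in> carrier_mat n n" "diagonal_mat D"
    and v: "v \<in> carrier_vec n" and i: "i < n" and N: "{j. (i, j) \<in> parcs G} \<subseteq> {0..<n}"
  shows "((adjacency_mat G + D) *\<^sub>v v) $ i =
    (\<Sum>j | (i, j) \<in> parcs G. v $ j) + D $$ (i, i) * v $ i"
proof -
  have "((adjacency_mat G + D) *\<^sub>v v) $ i = (\<Sum>j = 0..<n. (adjacency_mat G + D) $$ (i, j) * v $ j)"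
    using V D v i by (simp add: scalar_prod_def adjacency_mat_def)
  also have "\<dots> = (\<Sum>j = 0..<n. (if (i, j) \<in> parcs G then v $ j else 0) +
      (if j = i then D $$ (i, i) * v $ i else 0))"
    using V D i by (intro sum.cong) (auto simp: adjacency_mat_def diagonal_mat_def algebra_simps)
  also have "\<dots> = (\<Sum>j \<in> {0..<n} \<inter> {j. (i, j) \<in> parcs G}. v $ j) + D $$ (i, i) * v $ i"
    using i by (simp add: sum.distrib sum.delta sum.If_cases)
  also have "{0..<n} \<inter> {j. (i, j) \<in> parcs G} = {j. (i, j) \<in> parcs G}"
    using N by blast
  finally show ?thesis .
qed

text \<open>Substituting \<open>y k = v $ w k\<close> turns the rows of the kernel equation into the
  cyclic recurrence. By \<open>ne\<close> the sum over the neighbour set has two separate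
  terms.\<close>

lemma invertible_schroedinger_iff_trace:
  fixes D :: "'a::field mat"
  assumes V: "pverts G = {0..<n}" and n: "n \<ge> 1"
    and bij: "bij_betw w {0..<n} {0..<n}"
    and N: "\<And>k. k < n \<Longrightarrow> {j. (w k, j) \<in> parcs G} = {w (Suc k mod n), w ((k + n - 1) mod n)}"
    and ne: "\<And>k. k < n \<Longrightarrow> w (Suc k mod n) \<noteq> w ((k + n - 1) mod n)"
    and D: "D \<in> carrier_mat n n" "diagonal_mat D"
  shows "invertible_mat (adjacency_mat G + D) \<longleftrightarrow>
    transfer_trace (map (\<lambda>k. D $$ (w k, w k)) (rev [0..<n])) \<noteq> 2"
proof -
  let ?M = "adjacency_mat G + D"
  let ?rec = "\<lambda>y k. y (Suc k mod n) + y ((k + n - 1) mod n) + D $$ (w k, w k) * y k = 0"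
  have M: "?M \<in> carrier_mat n n" using V D by (simp add: adjacency_mat_def)
  have w: "w k < n" if "k < n" for k using bij_betwE[OF bij] that by simp
  have w_surj: "\<exists>k<n. w k = i" if "i < n" for i
    using bij that by (metis atLeastLessThan_iff bij_betw_def imageE less_eq_nat.simps(1))
  have row: "(?M *\<^sub>v v) $ w k =
      v $ w (Suc k mod n) + v $ w ((k + n - 1) mod n) + D $$ (w k, w k) * v $ w k"
    if "v \<in> carrier_vec n" "k < n" for v k
  proof -
    have "{j. (w k, j) \<in> parcs G} \<subseteq> {0..<n}" using N[OF that(2)] w n by auto
    then show ?thesis
      using schroedinger_mult_vec_index[OF V D that(1) w[OF that(2)]] N[OF that(2)] ne[OF that(2)]
      by simp
  qed
  have zero_iff: "u = 0\<^sub>v n \<longleftrightarrow> (\<forall>k<n. u $ w k = 0)" if "u \<in> carrier_vec n" for u :: "'a vec"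
    using that w w_surj by (auto simp: vec_eq_iff)
  have "(\<exists>v. v \<in> carrier_vec n \<and> v \<noteq> 0\<^sub>v n \<and> ?M *\<^sub>v v = 0\<^sub>v n) \<longleftrightarrow>
      (\<exists>y. (\<exists>k<n. y k \<noteq> 0) \<and> (\<forall>k<n. ?rec y k))"
  proof
    assume "\<exists>v. v \<in> carrier_vec n \<and> v \<noteq> 0\<^sub>v n \<and> ?M *\<^sub>v v = 0\<^sub>v n"
    then obtain v where v: "v \<in> carrier_vec n" "v \<noteq> 0\<^sub>v n" "?M *\<^sub>v v = 0\<^sub>v n" by blast
    have "?rec (\<lambda>k. v $ w k) k" if "k < n" for k
      using row[OF v(1) that] v(3) w[OF that] by simp
    moreover have "\<exists>k<n. v $ w k \<noteq> 0" using v zero_iff by blast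
    ultimately show "\<exists>y. (\<exists>k<n. y k \<noteq> 0) \<and> (\<forall>k<n. ?rec y k)"
      by (intro exI[of _ "\<lambda>k. v $ w k"]) blast
  next
    assume "\<exists>y. (\<exists>k<n. y k \<noteq> 0) \<and> (\<forall>k<n. ?rec y k)"
    then obtain y where y: "\<exists>k<n. y k \<noteq> 0" "\<And>k. k < n \<Longrightarrow> ?rec y k" by blast
    define v where "v = vec n (\<lambda>i. y (inv_into {0..<n} w i))"
    have v: "v \<in> carrier_vec n" by (simp add: v_def)
    have vw: "v $ w k = y k" if "k < n" for k
      using w[OF that] bij that by (simp add: v_def bij_betw_def inv_into_f_f)
    have "(?M *\<^sub>v v) $ w k = 0" if "k < n" for k
      using row[OF v that] y(2)[OF that] that n by (simp add: vw)
    then have "?M *\<^sub>v v = 0\<^sub>v n" using zero_iff[OF mult_mat_vec_carrier[OF M v]] by simp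
    moreover have "v \<noteq> 0\<^sub>v n" using y(1) zero_iff[OF v] vw by auto
    ultimately show "\<exists>v. v \<in> carrier_vec n \<and> v \<noteq> 0\<^sub>v n \<and> ?M *\<^sub>v v = 0\<^sub>v n" using v by blast
  qed
  then show ?thesis
    by (simp only: invertible_mat_iff_kernel_trivial[OF M] cyclic_recurrence_solvable_iff[OF n]
        not_not)
qed

lemma bij_betw_diagonal_mats_lists:
  assumes bij: "bij_betw w {0..<n} {0..<n}"
  shows "bij_betw (\<lambda>D :: 'a::zero mat. map (\<lambda>k. D $$ (w k, w k)) (rev [0..<n]))
    {D. D \<in> carrier_mat n n \<and> diagonal_mat D} {ds. length ds = n}"
proof (rule bij_betw_imageI)
  let ?f = "\<lambda>D :: 'a mat. map (\<lambda>k. D $$ (w k, w k)) (rev [0..<n])"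
  have w: "w k < n" if "k < n" for k using bij_betwE[OF bij] that by simp
  show "inj_on ?f {D. D \<in> carrier_mat n n \<and> diagonal_mat D}"
  proof (rule inj_onI)
    fix D E :: "'a mat"
    assume D: "D \<in> {D. D \<in> carrier_mat n n \<and> diagonal_mat D}"
      and E: "E \<in> {D. D \<in> carrier_mat n n \<and> diagonal_mat D}" and eq: "?f D = ?f E"
    have diag: "D $$ (i, i) = E $$ (i, i)" if "i < n" for i
    proof -
      have "i \<in> w ` {0..<n}" using bij that by (simp add: bij_betw_def)
      then obtain k where "k < n" "w k = i" by auto
      then show ?thesis using eq by auto
    qed
    show "D = E"
      using D E diag by (intro eq_matI) (auto simp: diagonal_mat_def, metis)
  qed
  show "?f ` {D. D \<in> carrier_mat n n \<and> diagonal_mat D} = {ds. length ds = n}"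
  proof (intro equalityI subsetI)
    fix ds :: "'a list"
    assume "ds \<in> {ds. length ds = n}"
    then have len: "length ds = n" by simp
    \<comment> \<open>The preimage undoes both the reversal of the list and the relabelling by
      \<open>w\<close>.\<close>
    define D where "D = mat n n (\<lambda>(i, j). if i = j then rev ds ! inv_into {0..<n} w i else 0)"
    have "D $$ (w k, w k) = rev ds ! k" if "k < n" for k
      using that w bij by (simp add: D_def bij_betw_def inv_into_f_f)
    then have "map (\<lambda>k. D $$ (w k, w k)) [0..<n] = rev ds"
      using len by (intro nth_equalityI) auto
    then have "?f D = ds" by (metis rev_map rev_rev_ident)
    moreover have "D \<in> carrier_mat n n" "diagonal_mat D"
      by (auto simp: D_def diagonal_mat_def)
    ultimately show "ds \<in> ?f ` {D. D \<in> carrier_mat n n \<and> diagonal_mat D}" by blast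
  qed auto
qed

lemma invertible_schroedinger_count_cycle:
  assumes G: "is_cycle_graph n G" and n: "n \<ge> 1"
  shows "real (invertible_schroedinger_count TYPE('a::{field,finite}) G) =
    real CARD('a) ^ n - real (continuant_count n (1 :: 'a))"
proof -
  have V: "pverts G = {0..<n}" using G by (simp add: is_cycle_graph_def)
  obtain w where w: "bij_betw w {0..<n} {0..<n}"
    "\<And>k. k < n \<Longrightarrow> {j. (w k, j) \<in> parcs G} = {w (Suc k mod n), w ((k + n - 1) mod n)}"
    "\<And>k. k < n \<Longrightarrow> w (Suc k mod n) \<noteq> w ((k + n - 1) mod n)"
    using cycle_graph_enum[OF G n] by blast
  let ?f = "\<lambda>D :: 'a mat. map (\<lambda>k. D $$ (w k, w k)) (rev [0..<n])"
  let ?S = "{D :: 'a mat. D \<in> carrier_mat n n \<and> diagonal_mat D}"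
  let ?T = "{ds :: 'a list. length ds = n}"
  let ?Z = "{ds :: 'a list. length ds = n \<and> transfer_trace ds = 2}"
  have bij: "bij_betw ?f ?S ?T" by (rule bij_betw_diagonal_mats_lists[OF w(1)])
  have iff: "invertible_mat (adjacency_mat G + D) \<longleftrightarrow> transfer_trace (?f D) \<noteq> 2" if "D \<in> ?S" for D
    by (rule invertible_schroedinger_iff_trace[OF V n w(1)], erule w(2), erule w(3))
       (use that in simp_all)
  have "invertible_schroedinger_count TYPE('a) G =
      card {D \<in> ?S. invertible_mat (adjacency_mat G + D)}"
    using V by (simp add: invertible_schroedinger_count_def conj_assoc)
  also have "\<dots> = card {ds \<in> ?T. transfer_trace ds \<noteq> 2}"
    by (intro bij_betw_same_card[of ?f] bij_betw_Collect[OF bij] iff[symmetric])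
  also have "{ds \<in> ?T. transfer_trace ds \<noteq> 2} = ?T - ?Z" by auto
  also have "card \<dots> = card ?T - card ?Z"
    by (rule card_Diff_subset) (auto intro: finite_subset[OF _ finite_lists_length[of n]])
  also have "card ?T = CARD('a) ^ n" by (rule card_lists_length)
  also have "card ?Z = continuant_count n (1 :: 'a)"
    using card_trace_eq_2[of "n - 1"] n by simp
  finally have count: "invertible_schroedinger_count TYPE('a) G =
      CARD('a) ^ n - continuant_count n (1 :: 'a)" .
  \<comment> \<open>This bound makes the natural number subtraction agree with the real one.\<close>
  have "continuant_count n (1 :: 'a) \<le> card ?T"
    unfolding continuant_count_def by (rule card_mono) auto
  then show ?thesis by (simp add: count card_lists_length of_nat_diff)
qed

theorem theorem2:
  fixes q :: nat
  assumes q: "q = CARD('a::{field,finite})"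
  shows
    "(odd q \<longrightarrow> (\<forall>n\<ge>1.
        (\<forall>G. is_cycle_graph (2*n+1) G \<longrightarrow>
           real (invertible_schroedinger_count TYPE('a) G)
             = real q ^ (2*n+1) - (1 - real q ^ (2*n+2)) / (1 - real q ^ 2)) \<and>
        (\<forall>G. is_cycle_graph (4*n) G \<longrightarrow>
           real (invertible_schroedinger_count TYPE('a) G)
             = real q ^ (4*n) - real q ^ (2*n)
               + (1 - real q ^ (2*n)) * (1 - real q ^ (2*n+1)) / (1 - real q ^ 2)) \<and>
        (\<forall>G. is_cycle_graph (4*n+2) G \<longrightarrow>
           real (invertible_schroedinger_count TYPE('a) G)
             = real q ^ (4*n+2)
               + (1 - real q ^ (2*n+1)) * (1 - real q ^ (2*n+2)) / (1 - real q ^ 2))))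
   \<and> (even q \<longrightarrow>
        (\<forall>n\<ge>1. \<forall>G. is_cycle_graph (2*n+1) G \<longrightarrow>
           real (invertible_schroedinger_count TYPE('a) G)
             = real q ^ (2*n+1) - (1 - real q ^ (2*n+2)) / (1 - real q ^ 2)) \<and>
        (\<forall>n\<ge>2. \<forall>G. is_cycle_graph (2*n) G \<longrightarrow>
           real (invertible_schroedinger_count TYPE('a) G)
             = real q ^ (2*n) - real q ^ n
               + (1 - real q ^ n) * (1 - real q ^ (n+1)) / (1 - real q ^ 2)))"
proof -
  have odd_cycle: "real (invertible_schroedinger_count TYPE('a) G) =
      real q ^ (2*n+1) - (1 - real q ^ (2*n+2)) / (1 - real q ^ 2)"
    if "is_cycle_graph (2*n+1) G" for n G
    using invertible_schroedinger_count_cycle[OF that, where ?'a = 'a]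
      continuant_count_odd_closed[of "1 :: 'a" n]
    unfolding q by simp
  \<comment> \<open>Only the test \<open>1 = (-1) ^ n\<close> depends on the case: it holds for even
    \<open>n\<close> and in characteristic 2, and fails for odd \<open>n\<close> otherwise.\<close>
  have even_cycle: "real (invertible_schroedinger_count TYPE('a) G) =
      real q ^ (2*n) - (if (1 :: 'a) = (-1) ^ n then real q ^ n else 0)
      + (1 - real q ^ n) * (1 - real q ^ (n+1)) / (1 - real q ^ 2)"
    if "is_cycle_graph (2*n) G" "n \<ge> 1" for n G
  proof -
    have "2 * n \<ge> 1" using that(2) by simp
    from invertible_schroedinger_count_cycle[OF that(1) this, where ?'a = 'a]
      continuant_count_even_closed[of "1 :: 'a" n]
    show ?thesis unfolding q by simp
  qed
  have zero_mod_4: "real (invertible_schroedinger_count TYPE('a) G) =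
      real q ^ (4*n) - real q ^ (2*n)
        + (1 - real q ^ (2*n)) * (1 - real q ^ (2*n+1)) / (1 - real q ^ 2)"
    if "is_cycle_graph (4*n) G" "n \<ge> 1" for n G
    using even_cycle[of "2*n" G] that by simp
  have two_mod_4: "real (invertible_schroedinger_count TYPE('a) G) =
      real q ^ (4*n+2)
        + (1 - real q ^ (2*n+1)) * (1 - real q ^ (2*n+2)) / (1 - real q ^ 2)"
    if "odd q" "is_cycle_graph (4*n+2) G" for n G
  proof -
    have eq: "2 * (2*n+1) = 4*n+2" "2*n+1+1 = 2*n+2" by simp_all
    have "(-1 :: 'a) ^ (2*n+1) = -1" by simp
    moreover have "(1 :: 'a) \<noteq> -1"
      using \<open>odd q\<close> even_card_field_iff[where ?'a = 'a] q by metis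
    ultimately have "(1 :: 'a) \<noteq> (-1) ^ (2*n+1)" by metis
    then show ?thesis using even_cycle[of "2*n+1" G] that(2) unfolding eq by simp
  qed
  have char_2: "real (invertible_schroedinger_count TYPE('a) G) =
      real q ^ (2*n) - real q ^ n
        + (1 - real q ^ n) * (1 - real q ^ (n+1)) / (1 - real q ^ 2)"
    if "even q" "is_cycle_graph (2*n) G" "n \<ge> 1" for n G
  proof -
    have "(-1 :: 'a) = 1" using \<open>even q\<close> even_card_field_iff[where ?'a = 'a] q by metis
    then have "(1 :: 'a) = (-1) ^ n" by (metis power_one)
    then show ?thesis using even_cycle[OF that(2,3)] by simp
  qed
  show ?thesis
    by (intro conjI impI allI;
        (rule odd_cycle | rule zero_mod_4 | rule two_mod_4 | rule char_2)) simp_all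
qed

end
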